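(* Let $m\ge1$, $\varphi=\frac{1+\sqrt5}2$, and $$T(m)=\frac{(3+\sqrt5)m-2+\sqrt{(38+6\sqrt5)m^2-4(11+\sqrt5)m+12}}{6m-2}.$$ Consider the SBS algorithm: let $r_j=u_j/t_j$ and $\tau_j=\min(t_j,u_j)$; let $B=\{j: r_j\ge T(m)\}$ and $S=[n]\setminus B$; let $S_1\subseteq S$ be a set with $|S_1|=\min(m,|S|)$ such that $\tau_{j_1}\ge\tau_{j_2}$ for all $j_1\in S_1$, $j_2\in S\setminus S_1$ (ties broken arbitrarily), and $S_2=S\setminus S_1$. The algorithm (1) places each job $j\in S_1$ on its own empty machine, testing it iff $r_j\ge\varphi$ and otherwise running it untested; (2) then, for each $j\in B$, tests $j$ and runs it on a currently least-loaded machine; (3) then, for each $j\in S_2$, runs $j$ untested on a currently least-loaded machine. Then the SBS algorithm is $T(m)\left(\frac32-\frac1{2m}\right)$-competitive for non-preemptive makespan minimization on $m$ identical machines with (general, non-uniform) testing times.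
   Context: Scheduling with testing on $m$ identical parallel machines: there are $n$ jobs $[n]=\{1,\dots,n\}$; each job $j$ has a testing time $t_j\ge 0$, an upper bound $u_j\ge 0$ and a processing time $p_j$ with $0\le p_j\le u_j$. A job can either be run untested, occupying a machine for time $u_j$, or be tested and then executed, occupying a machine for total time $t_j+p_j$; the value $p_j$ is revealed to the algorithm only when the test of $j$ is completed. Initially the algorithm knows $m$, $n$ and all $t_j,u_j$, but not the $p_j$. In the non-preemptive setting each job is assigned to a single machine and run there without interruption. The objective is the makespan (maximum machine load). $\mathrm{OPT}$ denotes the minimum makespan achievable by an offline scheduler knowing all $p_j$ (job $j$ needs time $\min(t_j+p_j,u_j)$ in the optimum). A deterministic algorithm is $c$-competitive if its makespan $\mathrm{ALG}$ satisfies $\mathrm{ALG}\le c\cdot\mathrm{OPT}$ on every instance. The ratio $u_j/t_j$ is interpreted as $+\infty$ when $t_j=0$. *)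

theory Defs
  imports Complex_Main "HOL-Library.Extended_Real"
begin

record test_instance =
  num_jobs :: nat
  test_time :: "nat \<Rightarrow> real"
  upper_bound :: "nat \<Rightarrow> real"
  proc_time :: "nat \<Rightarrow> real"

definition jobs :: "test_instance \<Rightarrow> nat set" where
  "jobs I = {1..num_jobs I}"

definition valid_instance :: "test_instance \<Rightarrow> bool" where
  "valid_instance I \<longleftrightarrow>
     (\<forall>j\<in>jobs I. 0 \<le> test_time I j \<and> 0 \<le> upper_bound I j \<and>
        0 \<le> proc_time I j \<and> proc_time I j \<le> upper_bound I j)"

datatype mode = Tested | Untested

primrec duration :: "test_instance \<Rightarrow> nat \<Rightarrow> mode \<Rightarrow> real" where
  "duration I j Tested = test_time I j + proc_time I j"
| "duration I j Untested = upper_bound I j"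

text \<open>A (partial) non-preemptive schedule on the machines \<open>1, \<dots>, m\<close> maps each job placed so far
  to its execution mode and its machine.\<close>

type_synonym schedule = "nat \<Rightarrow> (mode \<times> nat) option"

definition mode_of :: "schedule \<Rightarrow> nat \<Rightarrow> mode" where
  "mode_of s j = fst (the (s j))"

definition machine_of :: "schedule \<Rightarrow> nat \<Rightarrow> nat" where
  "machine_of s j = snd (the (s j))"

definition load :: "test_instance \<Rightarrow> schedule \<Rightarrow> nat \<Rightarrow> real" where
  "load I s i = (\<Sum>j\<in>{j \<in> dom s. machine_of s j = i}. duration I j (mode_of s j))"

definition makespan :: "nat \<Rightarrow> test_instance \<Rightarrow> schedule \<Rightarrow> real" where
  "makespan m I s = Max (load I s ` {1..m})"

definition feasible :: "nat \<Rightarrow> test_instance \<Rightarrow> schedule set" where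
  "feasible m I = {s. dom s = jobs I \<and> ran s \<subseteq> UNIV \<times> {1..m}}"

definition OPT :: "nat \<Rightarrow> test_instance \<Rightarrow> real" where
  "OPT m I = Min (makespan m I ` feasible m I)"

text \<open>An algorithm is given by its set of possible final schedules on each instance, one for
  every way of resolving arbitrary choices. Being competitive is a guarantee for all of them, hence
  for every deterministic implementation.\<close>

definition competitive :: "nat \<Rightarrow> real \<Rightarrow> (test_instance \<Rightarrow> schedule set) \<Rightarrow> bool" where
  "competitive m c A \<longleftrightarrow>
     (\<forall>I. valid_instance I \<longrightarrow> (\<forall>s\<in>A I. makespan m I s \<le> c * OPT m I))"

definition golden_ratio :: real where
  "golden_ratio = (1 + sqrt 5) / 2"

definition sbs_threshold :: "nat \<Rightarrow> real" where
  "sbs_threshold m =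
     ((3 + sqrt 5) * real m - 2
        + sqrt ((38 + 6 * sqrt 5) * (real m)\<^sup>2 - 4 * (11 + sqrt 5) * real m + 12))
     / (6 * real m - 2)"

definition ratio :: "test_instance \<Rightarrow> nat \<Rightarrow> ereal" where
  "ratio I j =
     (if test_time I j = 0 then \<infinity> else ereal (upper_bound I j / test_time I j))"

definition min_time :: "test_instance \<Rightarrow> nat \<Rightarrow> real" where
  "min_time I j = min (test_time I j) (upper_bound I j)"

definition sbs_B :: "nat \<Rightarrow> test_instance \<Rightarrow> nat set" where
  "sbs_B m I = {j \<in> jobs I. ratio I j \<ge> ereal (sbs_threshold m)}"

definition sbs_S :: "nat \<Rightarrow> test_instance \<Rightarrow> nat set" where
  "sbs_S m I = jobs I - sbs_B m I"

definition sbs_S1 :: "nat \<Rightarrow> test_instance \<Rightarrow> nat set \<Rightarrow> bool" where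
  "sbs_S1 m I S1 \<longleftrightarrow>
     S1 \<subseteq> sbs_S m I \<and> card S1 = min m (card (sbs_S m I)) \<and>
     (\<forall>j1\<in>S1. \<forall>j2\<in>sbs_S m I - S1. min_time I j1 \<ge> min_time I j2)"

definition sbs_initial :: "nat \<Rightarrow> test_instance \<Rightarrow> nat set \<Rightarrow> schedule \<Rightarrow> bool" where
  "sbs_initial m I S1 s \<longleftrightarrow>
     dom s = S1 \<and> inj_on (machine_of s) S1 \<and> machine_of s ` S1 \<subseteq> {1..m} \<and>
     (\<forall>j\<in>S1. mode_of s j = (if ratio I j \<ge> ereal golden_ratio then Tested else Untested))"

text \<open>\<open>list_schedule m I d s js s'\<close>: starting from \<open>s\<close>, the jobs \<open>js\<close> are run one after the other in
  mode \<open>d\<close>, each on some currently least-loaded machine, resulting in \<open>s'\<close>.\<close>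

inductive list_schedule ::
  "nat \<Rightarrow> test_instance \<Rightarrow> mode \<Rightarrow> schedule \<Rightarrow> nat list \<Rightarrow> schedule \<Rightarrow> bool"
  for m :: nat and I :: test_instance and d :: mode where
  list_schedule_Nil: "list_schedule m I d s [] s"
| list_schedule_Cons:
    "is_arg_min (load I s) (\<lambda>i. i \<in> {1..m}) i \<Longrightarrow>
     list_schedule m I d (s(j \<mapsto> (d, i))) js s' \<Longrightarrow>
     list_schedule m I d s (j # js) s'"

definition SBS :: "nat \<Rightarrow> test_instance \<Rightarrow> schedule set" where
  "SBS m I = {s. \<exists>S1 s1 bs s2 ss.
     sbs_S1 m I S1 \<and> sbs_initial m I S1 s1 \<and>
     distinct bs \<and> set bs = sbs_B m I \<and> list_schedule m I Tested s1 bs s2 \<and>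
     distinct ss \<and> set ss = sbs_S m I - S1 \<and> list_schedule m I Untested s2 ss s}"

subsection \<open>Well-definedness\<close>

lemma finite_feasible: "finite (feasible m I)"
proof -
  have "(UNIV :: mode set) = {Tested, Untested}"
    by (auto intro: mode.exhaust)
  then have "finite (UNIV :: mode set)" by (metis finite.emptyI finite_insert)
  then have "finite ((UNIV :: mode set) \<times> {1..m})" by simp
  then show ?thesis
    unfolding feasible_def by (intro finite_set_of_finite_maps) (auto simp: jobs_def)
qed

lemma feasible_nonempty:
  assumes "m \<ge> 1"
  shows "feasible m I \<noteq> {}"
proof -
  have "(\<lambda>j. if j \<in> jobs I then Some (Untested, 1) else None) \<in> feasible m I"
    using assms by (auto simp: feasible_def dom_def ran_def split: if_splits)
  then show ?thesis by blast
qed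

lemma list_schedule_dom_ran:
  assumes "list_schedule m I d s js s'" "ran s \<subseteq> UNIV \<times> {1..m}"
  shows "dom s' = dom s \<union> set js \<and> ran s' \<subseteq> UNIV \<times> {1..m}"
  using assms
proof (induction rule: list_schedule.induct)
  case (list_schedule_Nil s)
  then show ?case by simp
next
  case (list_schedule_Cons s i j js s')
  have "i \<in> {1..m}" using list_schedule_Cons.hyps(1) by (auto simp: is_arg_min_def)
  then have "ran (s(j \<mapsto> (d, i))) \<subseteq> UNIV \<times> {1..m}"
    using list_schedule_Cons.prems by (auto simp: ran_def split: if_splits)
  from list_schedule_Cons.IH[OF this]
  have "dom s' = dom (s(j \<mapsto> (d, i))) \<union> set js" "ran s' \<subseteq> UNIV \<times> {1..m}" by blast+
  then show ?case by simp
qed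

lemma list_schedule_exists:
  assumes "m \<ge> 1"
  shows "\<exists>s'. list_schedule m I d s js s'"
proof (induction js arbitrary: s)
  case Nil
  then show ?case by (blast intro: list_schedule_Nil)
next
  case (Cons j js)
  obtain i where "is_arg_min (load I s) (\<lambda>i. i \<in> {1..m}) i"
    using ex_is_arg_min_if_finite[of "{1..m}" "load I s"] assms by auto
  with Cons show ?case by (blast intro: list_schedule_Cons)
qed

lemma SBS_feasible: "SBS m I \<subseteq> feasible m I"
proof
  fix s assume "s \<in> SBS m I"
  then obtain S1 s1 bs s2 ss where *:
    "sbs_S1 m I S1" "sbs_initial m I S1 s1" "set bs = sbs_B m I"
    "list_schedule m I Tested s1 bs s2" "set ss = sbs_S m I - S1"
    "list_schedule m I Untested s2 ss s"
    by (auto simp: SBS_def)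
  have "ran s1 \<subseteq> UNIV \<times> {1..m}"
  proof
    fix x assume "x \<in> ran s1"
    then obtain j where j: "s1 j = Some x" by (auto simp: ran_def)
    then have "j \<in> dom s1" by blast
    then have "machine_of s1 j \<in> {1..m}" using *(2) unfolding sbs_initial_def by blast
    with j show "x \<in> UNIV \<times> {1..m}" by (cases x) (auto simp: machine_of_def)
  qed
  with list_schedule_dom_ran[OF *(4)] list_schedule_dom_ran[OF *(6)]
  have "dom s = S1 \<union> sbs_B m I \<union> (sbs_S m I - S1)" "ran s \<subseteq> UNIV \<times> {1..m}"
    using *(2,3,5) by (auto simp: sbs_initial_def)
  moreover have "S1 \<subseteq> sbs_S m I" using *(1) by (simp add: sbs_S1_def)
  ultimately show "s \<in> feasible m I"
    by (auto simp: feasible_def sbs_S_def sbs_B_def)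
qed

lemma exists_top_subset:
  fixes f :: "'a \<Rightarrow> real"
  assumes "finite A" "k \<le> card A"
  shows "\<exists>B\<subseteq>A. card B = k \<and> (\<forall>x\<in>B. \<forall>y\<in>A - B. f x \<ge> f y)"
  using assms(2)
proof (induction k)
  case 0
  then show ?case by (intro exI[of _ "{}"]) auto
next
  case (Suc k)
  then obtain B where B: "B \<subseteq> A" "card B = k" "\<forall>x\<in>B. \<forall>y\<in>A - B. f x \<ge> f y" by auto
  have "A - B \<noteq> {}" using Suc.prems B(1,2) by auto
  then obtain z where z: "z \<in> A - B" "\<forall>y\<in>A - B. f z \<ge> f y"
    using Max_in[of "f ` (A - B)"] Max_ge[of "f ` (A - B)"] assms(1)
    by (metis (no_types, lifting) finite_Diff finite_imageI image_iff image_is_empty)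
  have "card (insert z B) = Suc k"
    using z(1) B(1,2) assms(1) by (metis DiffD2 card_insert_disjoint finite_subset)
  then show ?case using B z by (intro exI[of _ "insert z B"]) auto
qed

lemma SBS_nonempty:
  assumes "m \<ge> 1"
  shows "SBS m I \<noteq> {}"
proof -
  have fin: "finite (sbs_B m I)" "finite (sbs_S m I)"
    by (auto simp: sbs_S_def sbs_B_def jobs_def)
  obtain S1 where S1: "sbs_S1 m I S1"
    using exists_top_subset[OF fin(2), of "min m (card (sbs_S m I))" "min_time I"]
    unfolding sbs_S1_def by auto
  have finS1: "finite S1" using S1 fin(2) by (auto simp: sbs_S1_def intro: finite_subset)
  have "card S1 \<le> card {1..m}" using S1 by (simp add: sbs_S1_def)
  then obtain g where g: "inj_on g S1" "g ` S1 \<subseteq> {1..m}"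
    using card_le_inj[OF finS1, of "{1..m}"] by auto
  define s1 :: schedule where
    "s1 j = (if j \<in> S1
             then Some (if ratio I j \<ge> ereal golden_ratio then Tested else Untested, g j)
             else None)" for j
  have "sbs_initial m I S1 s1"
    using g by (auto simp: sbs_initial_def s1_def machine_of_def mode_of_def inj_on_def dom_def)
  moreover obtain bs where "set bs = sbs_B m I" "distinct bs"
    using finite_distinct_list[OF fin(1)] by blast
  moreover obtain ss where "set ss = sbs_S m I - S1" "distinct ss"
    using finite_distinct_list[of "sbs_S m I - S1"] fin(2) by blast
  moreover obtain s2 where "list_schedule m I Tested s1 bs s2"
    using list_schedule_exists[OF assms] by blast
  moreover obtain s where "list_schedule m I Untested s2 ss s"
    using list_schedule_exists[OF assms] by blast
  ultimately have "s \<in> SBS m I" using S1 unfolding SBS_def by blast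
  then show ?thesis by blast
qed

end

theory Submission
  imports Defs
begin

text \<open>
  Write \<open>T\<close> for the threshold, \<open>\<phi>\<close> for the golden ratio and \<open>q\<^sub>j = min (t\<^sub>j + p\<^sub>j) u\<^sub>j\<close>. The algorithm
  spends at most \<open>\<phi> q\<^sub>j\<close> on a job of \<open>S\<^sub>1\<close>, at most \<open>(1 + 1/T) q\<^sub>j\<close> on a job of \<open>B\<close> and at most
  \<open>T \<tau>\<^sub>j\<close> on a job of \<open>S\<^sub>2\<close>, where \<open>1 + 1/T \<le> \<phi> \<le> T\<close>. Consider the last job \<open>j\<close> on a machine.
  If \<open>j \<in> S\<^sub>1\<close>, then the load is at most \<open>\<phi> OPT\<close>. If \<open>j \<in> B\<close>, averaging over the machines bounds
  the load by \<open>(\<phi> + (1 - 1/m) (1 + 1/T)) OPT\<close>. If \<open>j \<in> S\<^sub>2\<close>, then \<open>j\<close> and the \<open>m\<close> jobs of \<open>S\<^sub>1\<close> all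
  need at least \<open>\<tau>\<^sub>j\<close>, two of them share a machine in an optimal schedule, so \<open>2 \<tau>\<^sub>j \<le> OPT\<close> and
  averaging bounds the load by \<open>T (1 + (1 - 1/m) / 2) OPT\<close>. The threshold \<open>T\<close> is the value at which
  the last two bounds coincide.
\<close>

section \<open>The threshold\<close>

lemma golden_ratio_gt_1: "golden_ratio > 1"
  by (simp add: golden_ratio_def)

lemma golden_ratio_square: "golden_ratio * golden_ratio = golden_ratio + 1"
  by (simp add: golden_ratio_def field_simps)

text \<open>Clearing the denominator and isolating the root leaves
  \<open>2 * r * x + 1 - r \<le> sqrt D\<close>. The difference of the squares has the factor
  \<open>x - 1\<close>, so equality holds for \<open>m = 1\<close>.\<close>

lemma sbs_threshold_ge_golden_ratio:
  assumes "m \<ge> 1"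
  shows "golden_ratio \<le> sbs_threshold m"
proof -
  define x where "x = real m"
  define r where "r = sqrt 5"
  define D where "D = (38 + 6 * r) * x\<^sup>2 - 4 * (11 + r) * x + 12"
  have x: "x \<ge> 1" using assms by (simp add: x_def)
  have r: "r * r = 5" "r \<ge> 0" by (auto simp: r_def)
  have r_assoc: "r * (r * y) = 5 * y" for y using r(1) by (metis mult.assoc)
  have "D - (2 * r * x + 1 - r)\<^sup>2 = (6 + 2 * r) * ((3 * x - 1) * (x - 1))"
    unfolding D_def power2_eq_square by (simp add: algebra_simps r(1) r_assoc)
  moreover have "\<dots> \<ge> 0" using x r by simp
  ultimately have "2 * r * x + 1 - r \<le> sqrt D" by (intro real_le_rsqrt) simp
  then have "golden_ratio * (6 * x - 2) \<le> (3 + r) * x - 2 + sqrt D"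
    by (simp add: golden_ratio_def r_def field_simps)
  then show ?thesis
    using x by (simp add: sbs_threshold_def D_def x_def r_def pos_le_divide_eq)
qed

text \<open>Multiplied by \<open>2 * x * T\<close>, the equation becomes the quadratic \<open>(3 * x
  - 1) * T\<^sup>2 = ((3 + r) * x - 2) * T + 2 * (x - 1)\<close>, and the threshold is its larger
  root.\<close>

lemma sbs_threshold_balance:
  assumes "m \<ge> 1"
  shows "sbs_threshold m * (3 / 2 - 1 / (2 * real m)) =
    golden_ratio + (1 - 1 / real m) * (1 + 1 / sbs_threshold m)"
proof -
  define x where "x = real m"
  define r where "r = sqrt 5"
  define D where "D = (38 + 6 * r) * x\<^sup>2 - 4 * (11 + r) * x + 12"
  define T where "T = sbs_threshold m"
  have x: "x \<ge> 1" using assms by (simp add: x_def)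
  have r: "r * r = 5" "r \<ge> 0" by (auto simp: r_def)
  have r_assoc: "r * (r * y) = 5 * y" for y using r(1) by (metis mult.assoc)
  have T: "T > 0"
    using sbs_threshold_ge_golden_ratio[OF assms] golden_ratio_gt_1 by (simp add: T_def)
  \<comment> \<open>\<open>D\<close> is the discriminant of this quadratic.\<close>
  have D: "D - ((3 + r) * x - 2)\<^sup>2 = 8 * ((3 * x - 1) * (x - 1))"
    unfolding D_def power2_eq_square by (simp add: algebra_simps r(1) r_assoc)
  have "8 * ((3 * x - 1) * (x - 1)) \<ge> 0" using x by simp
  then have "D \<ge> 0" using D by (smt (verit) zero_le_power2)
  have "T * (6 * x - 2) = (3 + r) * x - 2 + sqrt D"
    using x by (simp add: T_def sbs_threshold_def D_def x_def r_def)
  then have "(T * (6 * x - 2) - ((3 + r) * x - 2))\<^sup>2 = D" using \<open>D \<ge> 0\<close> by simp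
  \<comment> \<open>Completing the square, for an arbitrary linear coefficient
    \<open>a\<close>.\<close>
  moreover have "4 * (3 * x - 1) * ((3 * x - 1) * T\<^sup>2 - a * T - 2 * (x - 1)) =
      (T * (6 * x - 2) - a)\<^sup>2 - a\<^sup>2 - 8 * ((3 * x - 1) * (x - 1))" for a
    by (simp add: power2_eq_square algebra_simps)
  ultimately have "4 * (3 * x - 1) * ((3 * x - 1) * T\<^sup>2 - ((3 + r) * x - 2) * T - 2 * (x - 1)) = 0"
    using D by simp
  then have *: "(3 * x - 1) * T\<^sup>2 = ((3 + r) * x - 2) * T + 2 * (x - 1)" using x by simp
  have "T * (3 / 2 - 1 / (2 * x)) * (2 * x * T) = (3 * x - 1) * T\<^sup>2"
    using x by (simp add: field_simps power2_eq_square)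
  also have "\<dots> = ((1 + r) / 2 + (1 - 1 / x) * (1 + 1 / T)) * (2 * x * T)"
    unfolding * using x T by (simp add: field_simps)
  finally show ?thesis using x T by (simp add: T_def x_def r_def golden_ratio_def)
qed

section \<open>Loads and list scheduling\<close>

lemma ran_subset_iff_machine_of:
  "ran s \<subseteq> UNIV \<times> M \<longleftrightarrow> machine_of s ` dom s \<subseteq> M"
  by (force simp: ran_def machine_of_def)

definition total_load :: "test_instance \<Rightarrow> schedule \<Rightarrow> real" where
  "total_load I s = (\<Sum>j\<in>dom s. duration I j (mode_of s j))"

lemma total_load_eq_sum_load:
  assumes "finite (dom s)" "machine_of s ` dom s \<subseteq> {1..m}"
  shows "total_load I s = (\<Sum>i\<in>{1..m}. load I s i)"
  unfolding total_load_def load_def using assms by (intro sum.group[symmetric]) auto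

lemma load_update:
  assumes "finite (dom s)" "j \<notin> dom s"
  shows "load I (s(j \<mapsto> (d, i))) k = load I s k + (if k = i then duration I j d else 0)"
proof -
  let ?A = "{l \<in> dom s. machine_of s l = k}"
  have "{l \<in> dom (s(j \<mapsto> (d, i))). machine_of (s(j \<mapsto> (d, i))) l = k} =
      (if k = i then insert j ?A else ?A)"
    using assms by (auto simp: machine_of_def)
  moreover have "(\<Sum>l\<in>?A. duration I l (mode_of (s(j \<mapsto> (d, i))) l)) = load I s k"
    unfolding load_def using assms by (intro sum.cong) (auto simp: mode_of_def)
  moreover have "mode_of (s(j \<mapsto> (d, i))) j = d" by (simp add: mode_of_def)
  ultimately show ?thesis
    using assms by (cases "k = i") (simp_all add: load_def[of _ "s(j \<mapsto> (d, i))"])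
qed

lemma total_load_update:
  assumes "finite (dom s)" "j \<notin> dom s"
  shows "total_load I (s(j \<mapsto> (d, i))) = total_load I s + duration I j d"
proof -
  have "(\<Sum>l\<in>dom s. duration I l (mode_of (s(j \<mapsto> (d, i))) l)) = total_load I s"
    unfolding total_load_def using assms by (intro sum.cong) (auto simp: mode_of_def)
  moreover have "mode_of (s(j \<mapsto> (d, i))) j = d" by (simp add: mode_of_def)
  ultimately show ?thesis using assms by (simp add: total_load_def)
qed

lemma list_schedule_total_load:
  assumes "list_schedule m I d s js s'" "finite (dom s)" "distinct js" "set js \<inter> dom s = {}"
  shows "total_load I s' = total_load I s + (\<Sum>j\<in>set js. duration I j d)"
  using assms
proof (induction rule: list_schedule.induct)
  case (list_schedule_Cons s i j js s')
  let ?s = "s(j \<mapsto> (d, i))"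
  have j: "j \<notin> dom s" "finite (dom s)" "j \<notin> set js" using list_schedule_Cons.prems by auto
  have "finite (dom ?s)" "distinct js" "set js \<inter> dom ?s = {}"
    using list_schedule_Cons.prems by simp_all
  then have "total_load I s' = total_load I ?s + (\<Sum>j\<in>set js. duration I j d)"
    by (rule list_schedule_Cons.IH)
  then show ?case using j by (simp add: total_load_update)
qed simp

text \<open>Graham's argument: just before the last job that matters for machine \<open>k\<close> is
  placed, \<open>k\<close> is least loaded, so \<open>m\<close> times its load is at most the total
  load. That job, of duration \<open>d\<close>, adds \<open>m * d\<close> on the left and
  \<open>d\<close> to the total, hence the term \<open>(m - 1) * d\<close>. Later jobs only increase
  the total.\<close>

lemma list_schedule_load:
  assumes "list_schedule m I d s js s'" "finite (dom s)" "machine_of s ` dom s \<subseteq> {1..m}"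
    "distinct js" "set js \<inter> dom s = {}" "\<And>j. j \<in> set js \<Longrightarrow> duration I j d \<ge> 0" "k \<in> {1..m}"
  shows "load I s' k = load I s k \<or>
    (\<exists>j\<in>set js. real m * load I s' k \<le> total_load I s' + (real m - 1) * duration I j d)"
  using assms
proof (induction rule: list_schedule.induct)
  case (list_schedule_Cons s i j js s')
  let ?s = "s(j \<mapsto> (d, i))"
  have i: "i \<in> {1..m}" "\<And>l. l \<in> {1..m} \<Longrightarrow> load I s i \<le> load I s l"
    using list_schedule_Cons.hyps(1) by (auto simp: is_arg_min_linorder)
  have j: "j \<notin> dom s" "finite (dom s)" using list_schedule_Cons.prems by auto
  have s: "finite (dom ?s)" "distinct js" "set js \<inter> dom ?s = {}"
    "\<And>j. j \<in> set js \<Longrightarrow> duration I j d \<ge> 0"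
    using list_schedule_Cons.prems by simp_all
  have "machine_of ?s ` dom ?s \<subseteq> {1..m}"
    using i(1) j list_schedule_Cons.prems(2) by (auto simp: machine_of_def image_subset_iff)
  then have IH: "load I s' k = load I ?s k \<or>
      (\<exists>j\<in>set js. real m * load I s' k \<le> total_load I s' + (real m - 1) * duration I j d)"
    using list_schedule_Cons.IH[OF s(1) _ s(2-4)] list_schedule_Cons.prems(6) by blast
  show ?case
  \<comment> \<open>In the first case \<open>j\<close> goes to \<open>k\<close> and nothing later
    changes the load of \<open>k\<close>, so \<open>j\<close> itself is the witness. Otherwise the
    induction hypothesis gives a witness, or the load of \<open>k\<close> never changes.\<close>
  proof (cases "load I s' k = load I ?s k \<and> k = i")
    case True
    have "real m * load I s i = (\<Sum>l\<in>{1..m}. load I s i)" by simp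
    also have "\<dots> \<le> (\<Sum>l\<in>{1..m}. load I s l)" by (intro sum_mono i)
    also have "\<dots> = total_load I s"
      using total_load_eq_sum_load list_schedule_Cons.prems by metis
    finally have "real m * load I s i \<le> total_load I s" .
    moreover have "total_load I s' = total_load I ?s + (\<Sum>j\<in>set js. duration I j d)"
      using list_schedule_Cons.hyps(2) s(1-3) by (rule list_schedule_total_load)
    moreover have "(\<Sum>j\<in>set js. duration I j d) \<ge> 0"
      using s(4) by (rule sum_nonneg)
    moreover have "load I s' k = load I s i + duration I j d"
      using True j by (auto simp: load_update)
    ultimately have "real m * load I s' k \<le> total_load I s' + (real m - 1) * duration I j d"
      using j by (simp add: total_load_update algebra_simps)
    then show ?thesis by auto
  next
    case False
    then show ?thesis using IH j by (auto simp: load_update)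
  qed
qed simp

section \<open>Lower bounds on the optimum\<close>

definition opt_time :: "test_instance \<Rightarrow> nat \<Rightarrow> real" where
  "opt_time I j = min (test_time I j + proc_time I j) (upper_bound I j)"

lemma opt_time_le_duration: "opt_time I j \<le> duration I j d"
  by (cases d) (auto simp: opt_time_def)

lemma min_time_le_opt_time:
  assumes "valid_instance I" "j \<in> jobs I"
  shows "0 \<le> min_time I j" "min_time I j \<le> opt_time I j"
  using assms by (force simp: valid_instance_def min_time_def opt_time_def)+

lemma duration_nonneg:
  assumes "valid_instance I" "j \<in> jobs I"
  shows "0 \<le> duration I j d"
  using assms by (cases d) (auto simp: valid_instance_def)

text \<open>The minimum ranges over a finite nonempty set. All lower bounds on \<open>OPT\<close>
  are read off the optimal schedule obtained here.\<close>

lemma OPT_attained: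
  assumes "m \<ge> 1"
  obtains s where "dom s = jobs I" "machine_of s ` jobs I \<subseteq> {1..m}"
    "\<And>i. i \<in> {1..m} \<Longrightarrow> load I s i \<le> OPT m I"
proof -
  have "OPT m I \<in> makespan m I ` feasible m I"
    unfolding OPT_def using finite_feasible feasible_nonempty[OF assms] by (intro Min_in) auto
  then obtain s where s: "s \<in> feasible m I" "OPT m I = makespan m I s" by auto
  have "machine_of s ` jobs I \<subseteq> {1..m}"
    using s(1) by (auto simp: feasible_def ran_subset_iff_machine_of)
  moreover have "load I s i \<le> OPT m I" if "i \<in> {1..m}" for i
    unfolding s(2) makespan_def using that by (intro Max_ge) auto
  ultimately show ?thesis using s(1) by (intro that[of s]) (auto simp: feasible_def)
qed

lemma sum_opt_time_le_OPT:
  assumes "m \<ge> 1"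
  shows "(\<Sum>j\<in>jobs I. opt_time I j) \<le> real m * OPT m I"
proof -
  obtain s where s: "dom s = jobs I" "machine_of s ` jobs I \<subseteq> {1..m}"
    "\<And>i. i \<in> {1..m} \<Longrightarrow> load I s i \<le> OPT m I"
    using OPT_attained[OF assms] by blast
  have "(\<Sum>j\<in>jobs I. opt_time I j) \<le> total_load I s"
    unfolding total_load_def s(1) by (intro sum_mono opt_time_le_duration)
  also have "\<dots> = (\<Sum>i\<in>{1..m}. load I s i)"
    using s by (intro total_load_eq_sum_load) (auto simp: jobs_def)
  also have "\<dots> \<le> (\<Sum>i\<in>{1..m}. OPT m I)" using s by (intro sum_mono) auto
  finally show ?thesis by simp
qed

text \<open>The remaining jobs on machine \<open>i\<close> have nonnegative durations. The bound is
  applied to sets of one and of two jobs.\<close>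

lemma sum_opt_time_le_load:
  assumes "valid_instance I" "dom s = jobs I" "A \<subseteq> jobs I" "\<And>j. j \<in> A \<Longrightarrow> machine_of s j = i"
  shows "(\<Sum>j\<in>A. opt_time I j) \<le> load I s i"
proof -
  have "(\<Sum>j\<in>A. opt_time I j) \<le> (\<Sum>j\<in>A. duration I j (mode_of s j))"
    by (intro sum_mono opt_time_le_duration)
  also have "\<dots> \<le> load I s i"
    unfolding load_def using assms duration_nonneg[OF assms(1)]
    by (intro sum_mono2) (auto simp: jobs_def)
  finally show ?thesis .
qed

lemma opt_time_le_OPT:
  assumes "m \<ge> 1" "valid_instance I" "j \<in> jobs I"
  shows "opt_time I j \<le> OPT m I"
proof -
  obtain s where s: "dom s = jobs I" "machine_of s ` jobs I \<subseteq> {1..m}"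
    "\<And>i. i \<in> {1..m} \<Longrightarrow> load I s i \<le> OPT m I"
    using OPT_attained[OF assms(1)] by blast
  have "opt_time I j \<le> load I s (machine_of s j)"
    using sum_opt_time_le_load[OF assms(2) s(1), of "{j}" "machine_of s j"] assms(3) by auto
  also have "\<dots> \<le> OPT m I" using s assms(3) by blast
  finally show ?thesis .
qed

lemma OPT_nonneg:
  assumes "m \<ge> 1" "valid_instance I"
  shows "0 \<le> OPT m I"
proof -
  have "0 \<le> (\<Sum>j\<in>jobs I. opt_time I j)"
    using min_time_le_opt_time[OF assms(2)] by (intro sum_nonneg) (meson order_trans)
  with sum_opt_time_le_OPT[OF assms(1), of I] have "0 \<le> real m * OPT m I" by linarith
  then show ?thesis using assms(1) by (simp add: zero_le_mult_iff)
qed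

text \<open>By the pigeonhole principle, two jobs of \<open>A\<close> share a machine in an optimal
  schedule.\<close>

lemma OPT_ge_twice_opt_time:
  assumes "m \<ge> 1" "valid_instance I" "A \<subseteq> jobs I" "card A > m"
    "\<And>j. j \<in> A \<Longrightarrow> x \<le> opt_time I j"
  shows "2 * x \<le> OPT m I"
proof -
  obtain s where s: "dom s = jobs I" "machine_of s ` jobs I \<subseteq> {1..m}"
    "\<And>i. i \<in> {1..m} \<Longrightarrow> load I s i \<le> OPT m I"
    using OPT_attained[OF assms(1)] by blast
  have "card (machine_of s ` A) \<le> card {1..m}" using s(2) assms(3) by (intro card_mono) (simp, blast)
  then have "\<not> inj_on (machine_of s) A" using assms(4) by (intro pigeonhole) simp
  then obtain j k where jk: "j \<in> A" "k \<in> A" "j \<noteq> k" "machine_of s j = machine_of s k"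
    by (auto simp: inj_on_def)
  have "2 * x \<le> (\<Sum>l\<in>{j, k}. opt_time I l)"
    using jk assms(5)[OF jk(1)] assms(5)[OF jk(2)] by simp
  also have "\<dots> \<le> load I s (machine_of s j)"
    using jk assms by (intro sum_opt_time_le_load s) auto
  also have "\<dots> \<le> OPT m I" using s jk assms(3) by blast
  finally show ?thesis .
qed

section \<open>Cost of each job\<close>

text \<open>If the optimum skips the test, then \<open>t \<le> u / c\<close> and
  \<open>p \<le> u\<close> give \<open>t + p \<le> (1 + 1 / c) * u\<close>; if it tests, the factor
  is merely at least 1. A job with \<open>t = 0\<close> satisfies \<open>c * t \<le> u\<close>
  trivially.\<close>

lemma duration_Tested_le:
  assumes "valid_instance I" "j \<in> jobs I" "ereal c \<le> ratio I j" "c > 0"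
  shows "duration I j Tested \<le> (1 + 1 / c) * opt_time I j"
proof -
  have v: "0 \<le> test_time I j" "0 \<le> upper_bound I j" "0 \<le> proc_time I j"
    "proc_time I j \<le> upper_bound I j"
    using assms by (auto simp: valid_instance_def)
  have "c * test_time I j \<le> upper_bound I j"
    using assms v by (auto simp: ratio_def field_simps split: if_splits)
  then have "test_time I j \<le> upper_bound I j / c" using assms(4) by (simp add: field_simps)
  then have "test_time I j + proc_time I j \<le> (1 + 1 / c) * upper_bound I j"
    using v by (simp add: algebra_simps)
  moreover have "test_time I j + proc_time I j \<le> (1 + 1 / c) * (test_time I j + proc_time I j)"
    using v assms(4) by (simp add: algebra_simps)
  ultimately show ?thesis by (simp add: opt_time_def min_def)
qed

lemma duration_Untested_le:
  assumes "valid_instance I" "j \<in> jobs I" "ratio I j < ereal c" "c \<ge> 1"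
  shows "duration I j Untested \<le> c * min_time I j"
proof -
  have v: "0 \<le> test_time I j" "0 \<le> upper_bound I j"
    using assms by (auto simp: valid_instance_def)
  have "upper_bound I j \<le> c * test_time I j"
    using assms v by (auto simp: ratio_def field_simps split: if_splits)
  moreover have "upper_bound I j \<le> c * upper_bound I j"
    using v assms(4) by (simp add: mult_le_cancel_right1)
  ultimately show ?thesis by (simp add: min_time_def min_def)
qed

text \<open>The golden ratio balances the costs of testing and of not testing, since it is the
  positive solution of \<open>1 + 1 / c = c\<close>.\<close>

lemma duration_golden_ratio_le:
  assumes "valid_instance I" "j \<in> jobs I"
  shows "duration I j (if ratio I j \<ge> ereal golden_ratio then Tested else Untested)
    \<le> golden_ratio * opt_time I j"
proof (cases "ratio I j \<ge> ereal golden_ratio")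
  case True
  have "1 + 1 / golden_ratio = golden_ratio"
    using golden_ratio_square golden_ratio_gt_1 by (simp add: field_simps)
  then show ?thesis
    using duration_Tested_le[OF assms True] golden_ratio_gt_1 True by simp
next
  case False
  then have "duration I j Untested \<le> golden_ratio * min_time I j"
    using golden_ratio_gt_1 by (intro duration_Untested_le[OF assms]) auto
  also have "\<dots> \<le> golden_ratio * opt_time I j"
    using min_time_le_opt_time[OF assms] golden_ratio_gt_1 by (intro mult_left_mono) auto
  finally show ?thesis using False by simp
qed

section \<open>The competitive ratio\<close>

lemma sbs_load_le:
  assumes m: "m \<ge> 1" and I: "valid_instance I" and s: "s \<in> SBS m I" and k: "k \<in> {1..m}"
  shows "load I s k \<le> sbs_threshold m * (3 / 2 - 1 / (2 * real m)) * OPT m I"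
proof -
  obtain S1 s1 bs s2 ss where *:
    "sbs_S1 m I S1" "sbs_initial m I S1 s1" "distinct bs" "set bs = sbs_B m I"
    "list_schedule m I Tested s1 bs s2" "distinct ss" "set ss = sbs_S m I - S1"
    "list_schedule m I Untested s2 ss s"
    using s by (auto simp: SBS_def)
  define T where "T = sbs_threshold m"
  define c where "c = T * (3 / 2 - 1 / (2 * real m))"
  let ?\<phi> = golden_ratio and ?O = "OPT m I" and ?q = "opt_time I"
  let ?B = "sbs_B m I" and ?S2 = "sbs_S m I - S1"
  have c: "c = ?\<phi> + (1 - 1 / real m) * (1 + 1 / T)"
    unfolding c_def T_def by (rule sbs_threshold_balance[OF m])
  have \<phi>: "?\<phi> > 1" "?\<phi> \<le> T"
    using golden_ratio_gt_1 sbs_threshold_ge_golden_ratio[OF m] by (auto simp: T_def)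
  have T\<phi>: "1 + 1 / T \<le> ?\<phi>"
  proof -
    have "1 / T \<le> 1 / ?\<phi>" using \<phi> by (intro divide_left_mono) auto
    also have "\<dots> = ?\<phi> - 1"
      using golden_ratio_square \<phi> by (simp add: field_simps)
    finally show ?thesis by simp
  qed
  have O: "0 \<le> ?O" using OPT_nonneg[OF m I] .
  have q: "0 \<le> ?q j" "?q j \<le> ?O" if "j \<in> jobs I" for j
    using min_time_le_opt_time[OF I that] opt_time_le_OPT[OF m I that] by auto
  have S1: "S1 \<subseteq> sbs_S m I" and SB: "?B \<subseteq> jobs I" "sbs_S m I = jobs I - ?B"
    using *(1) by (auto simp: sbs_S1_def sbs_B_def sbs_S_def)
  have disj: "?B \<inter> S1 = {}" "?S2 \<inter> (S1 \<union> ?B) = {}" using S1 SB by auto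
  have fin: "finite (jobs I)" by (simp add: jobs_def)
  then have finite: "finite S1" "finite ?B" "finite ?S2"
    using S1 SB by (auto intro: finite_subset)
  have s1: "dom s1 = S1" "inj_on (machine_of s1) S1" "machine_of s1 ` S1 \<subseteq> {1..m}"
    "\<And>j. j \<in> S1 \<Longrightarrow> mode_of s1 j = (if ratio I j \<ge> ereal ?\<phi> then Tested else Untested)"
    using *(2) by (auto simp: sbs_initial_def)
  have dur1: "duration I j (mode_of s1 j) \<le> ?\<phi> * ?q j" if "j \<in> S1" for j
    using that S1 SB duration_golden_ratio_le[OF I, of j] s1(4)[OF that] by auto
  have durB: "duration I j Tested \<le> (1 + 1 / T) * ?q j" if "j \<in> ?B" for j
    using that \<phi> by (intro duration_Tested_le[OF I]) (auto simp: sbs_B_def T_def)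
  have dur2: "duration I j Untested \<le> T * min_time I j" if "j \<in> ?S2" for j
    using that \<phi> by (intro duration_Untested_le[OF I]) (auto simp: sbs_B_def sbs_S_def T_def)
  \<comment> \<open>Injectivity of the initial placement leaves at most one job on machine
    \<open>k\<close>.\<close>
  have load1: "load I s1 k \<le> ?\<phi> * ?O"
  proof (cases "\<exists>j\<in>S1. machine_of s1 j = k")
    case True
    then obtain j where j: "j \<in> S1" "machine_of s1 j = k" by blast
    then have "{j \<in> dom s1. machine_of s1 j = k} = {j}"
      using s1(1,2) by (auto simp: inj_on_def)
    then have "load I s1 k = duration I j (mode_of s1 j)" by (simp add: load_def)
    also have "\<dots> \<le> ?\<phi> * ?q j" using dur1[OF j(1)] .
    also have "\<dots> \<le> ?\<phi> * ?O" using q[of j] j S1 SB \<phi> by (intro mult_left_mono) auto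
    finally show ?thesis .
  next
    case False
    then have "{j \<in> dom s1. machine_of s1 j = k} = {}" using s1 by auto
    then have "load I s1 k = 0" by (simp only: load_def sum.empty)
    then show ?thesis using O \<phi> by simp
  qed
  have "1 / real m \<le> 1" using m by simp
  then have c\<phi>: "?\<phi> \<le> c" unfolding c using \<phi> by simp
  have tot1: "total_load I s1 \<le> ?\<phi> * (\<Sum>j\<in>S1. ?q j)"
    unfolding total_load_def s1(1) sum_distrib_left by (intro sum_mono dur1)
  have totB: "(\<Sum>j\<in>?B. duration I j Tested) \<le> (1 + 1 / T) * (\<Sum>j\<in>?B. ?q j)"
    unfolding sum_distrib_left by (intro sum_mono durB)
  have tot2: "(\<Sum>j\<in>?S2. duration I j Untested) \<le> T * (\<Sum>j\<in>?S2. ?q j)"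
    unfolding sum_distrib_left
  proof (intro sum_mono)
    fix j assume j: "j \<in> ?S2"
    have "T * min_time I j \<le> T * ?q j"
      using min_time_le_opt_time[OF I] j SB \<phi> by (intro mult_left_mono) auto
    then show "duration I j Untested \<le> T * ?q j" using dur2[OF j] by simp
  qed
  have total2: "total_load I s2 = total_load I s1 + (\<Sum>j\<in>?B. duration I j Tested)"
    using list_schedule_total_load[OF *(5)] *(3,4) s1(1) disj finite by simp
  have s2: "dom s2 = S1 \<union> ?B" "machine_of s2 ` dom s2 \<subseteq> {1..m}"
  proof -
    have "ran s1 \<subseteq> UNIV \<times> {1..m}" using s1(1,3) by (simp add: ran_subset_iff_machine_of)
    then have "dom s2 = S1 \<union> ?B \<and> ran s2 \<subseteq> UNIV \<times> {1..m}"
      using list_schedule_dom_ran[OF *(5)] *(4) s1(1) by simp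
    then show "dom s2 = S1 \<union> ?B" "machine_of s2 ` dom s2 \<subseteq> {1..m}"
      unfolding ran_subset_iff_machine_of by blast+
  qed
  have total: "total_load I s = total_load I s2 + (\<Sum>j\<in>?S2. duration I j Untested)"
    using list_schedule_total_load[OF *(8)] *(6,7) s2(1) disj finite by simp
  have qsum: "(\<Sum>j\<in>S1. ?q j) + (\<Sum>j\<in>?B. ?q j) + (\<Sum>j\<in>?S2. ?q j) = (\<Sum>j\<in>jobs I. ?q j)"
  proof -
    have "jobs I = (S1 \<union> ?B) \<union> ?S2" using S1 SB by auto
    moreover have "S1 \<inter> ?B = {}" "(S1 \<union> ?B) \<inter> ?S2 = {}" using disj by auto
    ultimately show ?thesis using finite by (simp add: sum.union_disjoint)
  qed
  have qO: "(\<Sum>j\<in>jobs I. ?q j) \<le> real m * ?O" by (rule sum_opt_time_le_OPT[OF m])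
  have q1: "(\<Sum>j\<in>S1. ?q j) \<ge> 0" and qB: "(\<Sum>j\<in>?B. ?q j) \<ge> 0" and q2: "(\<Sum>j\<in>?S2. ?q j) \<ge> 0"
    using q S1 SB by (auto intro!: sum_nonneg)
  have load2: "load I s2 k \<le> c * ?O"
  proof -
    have "load I s2 k = load I s1 k \<or>
        (\<exists>j\<in>?B. real m * load I s2 k \<le> total_load I s2 + (real m - 1) * duration I j Tested)"
      using *(3) s1 disj SB finite k duration_nonneg[OF I]
      by (intro list_schedule_load[OF *(5), unfolded *(4)]) (auto simp del: duration.simps)
    then consider "load I s2 k = load I s1 k"
      | j where "j \<in> ?B"
          "real m * load I s2 k \<le> total_load I s2 + (real m - 1) * duration I j Tested"
      by blast
    then show ?thesis
    proof cases
      case 1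
      have "?\<phi> * ?O \<le> c * ?O" using c\<phi> O by (rule mult_right_mono)
      then show ?thesis using 1 load1 by simp
    next
      case 2
      \<comment> \<open>At this stage the total contains only jobs of \<open>S1\<close> and
        \<open>B\<close>, so all of it can be charged at rate \<phi> rather than
        \<open>T\<close>.\<close>
      have "(1 + 1 / T) * (\<Sum>j\<in>?B. ?q j) \<le> ?\<phi> * (\<Sum>j\<in>?B. ?q j)"
        using T\<phi> qB by (rule mult_right_mono)
      then have "total_load I s2 \<le> ?\<phi> * ((\<Sum>j\<in>S1. ?q j) + (\<Sum>j\<in>?B. ?q j))"
        using total2 tot1 totB by (simp add: distrib_left)
      also have "\<dots> \<le> ?\<phi> * (real m * ?O)"
        using \<phi> qsum qO q2 by (intro mult_left_mono) auto
      finally have t: "total_load I s2 \<le> ?\<phi> * (real m * ?O)" .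
      have "duration I j Tested \<le> (1 + 1 / T) * ?q j" using durB[OF 2(1)] .
      also have "\<dots> \<le> (1 + 1 / T) * ?O" using q[of j] 2(1) SB \<phi> by (intro mult_left_mono) auto
      finally have "(real m - 1) * duration I j Tested \<le> (real m - 1) * ((1 + 1 / T) * ?O)"
        using m by (intro mult_left_mono) auto
      then have "real m * load I s2 k \<le> ?\<phi> * (real m * ?O) + (real m - 1) * ((1 + 1 / T) * ?O)"
        using 2(2) t by linarith
      \<comment> \<open>This uses \<open>c\<close> in its balanced form; the case of
        \<open>S2\<close> below uses its definition.\<close>
      also have "\<dots> = real m * (c * ?O)"
        unfolding c using m \<phi> by (simp add: field_simps)
      finally show ?thesis using m by simp
    qed
  qed
  have "load I s k = load I s2 k \<or>
      (\<exists>j\<in>?S2. real m * load I s k \<le> total_load I s + (real m - 1) * duration I j Untested)"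
    using *(6) s2 disj SB finite k duration_nonneg[OF I]
    by (intro list_schedule_load[OF *(8), unfolded *(7)]) (simp_all del: duration.simps)
  then consider "load I s k = load I s2 k"
    | j where "j \<in> ?S2"
        "real m * load I s k \<le> total_load I s + (real m - 1) * duration I j Untested"
    by blast
  then have "load I s k \<le> c * ?O"
  proof cases
    case 1
    then show ?thesis using load2 by simp
  next
    case 2
    \<comment> \<open>Now the jobs of \<open>S2\<close> count too, and \<open>T\<close> dominates
      all three rates.\<close>
    have "?\<phi> * (\<Sum>j\<in>S1. ?q j) \<le> T * (\<Sum>j\<in>S1. ?q j)"
      using \<phi>(2) q1 by (rule mult_right_mono)
    moreover have "(1 + 1 / T) * (\<Sum>j\<in>?B. ?q j) \<le> T * (\<Sum>j\<in>?B. ?q j)"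
      using T\<phi> \<phi>(2) qB by (intro mult_right_mono) auto
    ultimately have "total_load I s \<le>
        T * ((\<Sum>j\<in>S1. ?q j) + (\<Sum>j\<in>?B. ?q j) + (\<Sum>j\<in>?S2. ?q j))"
      using total total2 tot1 totB tot2 by (simp add: distrib_left)
    also have "\<dots> \<le> T * (real m * ?O)"
      unfolding qsum using \<phi> qO by (intro mult_left_mono) auto
    finally have t: "total_load I s \<le> T * (real m * ?O)" .
    \<comment> \<open>A job outside \<open>S1\<close> exists, so the minimum defining the size of
      \<open>S1\<close> is \<open>m\<close>; together with \<open>j\<close> this makes
      \<open>m + 1\<close> jobs, enough for the pigeonhole bound.\<close>
    have "S1 \<noteq> sbs_S m I" using 2(1) by auto
    then have "card S1 < card (sbs_S m I)"
      using S1 SB fin by (intro psubset_card_mono) auto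
    then have "card S1 = m" using *(1) by (auto simp: sbs_S1_def)
    then have "card (insert j S1) > m" using 2(1) finite by simp
    moreover have "min_time I j \<le> ?q i" if "i \<in> insert j S1" for i
    proof -
      \<comment> \<open>This is where the choice of \<open>S1\<close> as the jobs of largest
        \<open>min_time\<close> enters.\<close>
      have "min_time I j \<le> min_time I i" using that *(1) 2(1) by (auto simp: sbs_S1_def)
      also have "\<dots> \<le> ?q i" using min_time_le_opt_time[OF I, of i] that S1 SB 2(1) by auto
      finally show ?thesis .
    qed
    ultimately have "2 * min_time I j \<le> ?O"
      using S1 SB 2(1) by (intro OPT_ge_twice_opt_time[OF m I, of "insert j S1"]) auto
    \<comment> \<open>The gain of a factor 2 on the last job produces the ratio
      \<open>3 / 2 - 1 / (2 * m)\<close>.\<close>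
    then have "T * min_time I j \<le> T * (?O / 2)" using \<phi> by (intro mult_left_mono) auto
    then have "(real m - 1) * duration I j Untested \<le> (real m - 1) * (T * (?O / 2))"
      using m dur2[OF 2(1)] by (intro mult_left_mono) auto
    then have "real m * load I s k \<le> T * (real m * ?O) + (real m - 1) * (T * (?O / 2))"
      using 2(2) t by linarith
    also have "\<dots> = real m * (c * ?O)"
      unfolding c_def using m by (simp add: field_simps)
    finally show ?thesis using m by simp
  qed
  then show ?thesis by (simp add: c_def T_def)
qed

theorem theorem3:
  fixes m :: nat
  assumes "m \<ge> 1"
  shows "competitive m (sbs_threshold m * (3 / 2 - 1 / (2 * real m))) (SBS m)"
  unfolding competitive_def makespan_def using assms sbs_load_le[OF assms] by auto

end
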